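(* Let $j:\mathbb{R}\to\mathbb{R}$ be a $1$-periodic odd piecewise continuous function with $\sup_{x\in[0,1]}|j(x)|<\infty$. Let $F$ be a continuous function which has bounded variation on $\left[\frac12,1\right]$. Then $$\int_{1/2}^1 j(2^n\,?(x))\,F(x)\,\mathrm{d}x=O(n^{-1}),\qquad n\to\infty,$$ where $?(x)$ is the Minkowski question mark function (the implied constant may depend on $j$ and $F$).
   Context: Minkowski question mark function: the continuous strictly increasing function $?:[0,1]\to[0,1]$ given, for $x$ with continued fraction expansion $x=[0;a_1,a_2,\dots]$, by $?(x)=2\sum_{n\ge1}(-1)^{n-1}2^{-(a_1+\dots+a_n)}$ (a finite sum if $x$ is rational), with $?(0)=0$, $?(1)=1$. *)

theory Defs
  imports "HOL-Analysis.Analysis" "HOL-Library.Landau_Symbols"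
begin

text \<open>
  Continued fraction expansion of \<open>x \<in> [0,1]\<close> by iterating the Gauss map. The partial quotient
  \<open>a\<^sub>n\<^sub>+\<^sub>1\<close> of \<open>x = [0; a\<^sub>1, a\<^sub>2, \<dots>]\<close> is \<open>cfrac_digit x n\<close>. The expansion has terminated before
  \<open>a\<^sub>n\<^sub>+\<^sub>1\<close> iff the \<open>n\<close>-th remainder \<open>(gauss_map ^^ n) x\<close> is \<open>0\<close>.
\<close>

definition gauss_map :: "real \<Rightarrow> real" where
  "gauss_map x = frac (1 / x)"

definition cfrac_digit :: "real \<Rightarrow> nat \<Rightarrow> nat" where
  "cfrac_digit x n = nat \<lfloor>1 / (gauss_map ^^ n) x\<rfloor>"

text \<open>
  The Minkowski question mark function; the definition is only meaningful on \<open>[0,1]\<close>. Indices are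
  shifted by one, so that \<open>(-1)\<^sup>n\<close> here is the \<open>(-1)\<^sup>n\<^sup>-\<^sup>1\<close> of the usual formula. The conditional makes
  the series a finite sum for rational \<open>x\<close>.
\<close>

definition question_mark :: "real \<Rightarrow> real" where
  "question_mark x = 2 * (\<Sum>n. if (gauss_map ^^ n) x = 0 then 0
                              else (-1) ^ n / 2 ^ (\<Sum>i\<le>n. cfrac_digit x i))"

lemma gauss_map_0 [simp]: "gauss_map 0 = 0"
  by (simp add: gauss_map_def)

lemma gauss_map_bounds: "0 \<le> gauss_map x" "gauss_map x < 1"
  by (simp_all add: gauss_map_def frac_lt_1)

lemma gauss_map_funpow_bounds:
  assumes "0 \<le> x" "x \<le> 1"
  shows "0 \<le> (gauss_map ^^ n) x" "(gauss_map ^^ n) x \<le> 1"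
  using assms gauss_map_bounds by (cases n; auto intro: less_imp_le)+

lemma cfrac_step:
  assumes "0 \<le> x" "x \<le> 1" "(gauss_map ^^ n) x \<noteq> 0"
  shows "(gauss_map ^^ n) x = 1 / (real (cfrac_digit x n) + (gauss_map ^^ Suc n) x)"
proof -
  define r where "r = (gauss_map ^^ n) x"
  have r: "0 < r"
    using gauss_map_funpow_bounds(1)[OF assms(1,2), of n] assms(3) by (simp add: r_def)
  have "real (nat \<lfloor>1 / r\<rfloor>) + frac (1 / r) = 1 / r"
    using r by (simp add: frac_def)
  then have "r = 1 / (real (nat \<lfloor>1 / r\<rfloor>) + frac (1 / r))"
    by simp
  then show ?thesis
    by (simp add: r_def cfrac_digit_def gauss_map_def)
qed

lemma cfrac_digit_pos:
  assumes "0 \<le> x" "x \<le> 1" "(gauss_map ^^ n) x \<noteq> 0"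
  shows "1 \<le> cfrac_digit x n"
proof -
  have "1 \<le> 1 / (gauss_map ^^ n) x"
    using gauss_map_funpow_bounds[OF assms(1,2), of n] assms(3) by (simp add: field_simps)
  then have "1 \<le> \<lfloor>1 / (gauss_map ^^ n) x\<rfloor>"
    by simp
  then show ?thesis
    unfolding cfrac_digit_def by linarith
qed

lemma gauss_map_funpow_0_mono:
  assumes "(gauss_map ^^ m) x = 0" "m \<le> n"
  shows "(gauss_map ^^ n) x = 0"
  using assms(2,1) by (induction rule: dec_induct) auto

lemma question_mark_summable:
  assumes "0 \<le> x" "x \<le> 1"
  shows "summable (\<lambda>n. if (gauss_map ^^ n) x = 0 then 0
                       else (-1) ^ n / 2 ^ (\<Sum>i\<le>n. cfrac_digit x i) :: real)"
proof (rule summable_comparison_test')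
  show "summable (\<lambda>n. (1 / 2) ^ n :: real)"
    by (rule summable_geometric) simp
  show "norm (if (gauss_map ^^ n) x = 0 then 0
              else (-1) ^ n / 2 ^ (\<Sum>i\<le>n. cfrac_digit x i) :: real) \<le> (1 / 2) ^ n" for n
  proof (cases "(gauss_map ^^ n) x = 0")
    case False
    have "1 \<le> cfrac_digit x i" if "i \<le> n" for i
      using cfrac_digit_pos[OF assms] gauss_map_funpow_0_mono[OF _ that] False by blast
    then have "(\<Sum>i\<le>n. 1) \<le> (\<Sum>i\<le>n. cfrac_digit x i)"
      by (intro sum_mono) auto
    then have "n \<le> (\<Sum>i\<le>n. cfrac_digit x i)"
      by simp
    then have "(2::real) ^ n \<le> 2 ^ (\<Sum>i\<le>n. cfrac_digit x i)"
      by (rule power_increasing) simp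
    then show ?thesis
      using False by (simp add: power_divide frac_le)
  qed simp
qed

lemma question_mark_0: "question_mark 0 = 0"
proof -
  have "(gauss_map ^^ n) 0 = 0" for n
    by (induction n) auto
  then show ?thesis
    by (simp add: question_mark_def)
qed

lemma question_mark_inverse_nat:
  assumes "m \<ge> 1"
  shows "question_mark (1 / real m) = 2 / 2 ^ m"
proof -
  have g: "(gauss_map ^^ n) (1 / real m) = 0" if "n \<ge> 1" for n
    by (rule gauss_map_funpow_0_mono[OF _ that]) (simp add: gauss_map_def)
  have "(\<Sum>n. if (gauss_map ^^ n) (1 / real m) = 0 then 0
              else (-1) ^ n / 2 ^ (\<Sum>i\<le>n. cfrac_digit (1 / real m) i) :: real)
      = (\<Sum>n\<in>{0}. if (gauss_map ^^ n) (1 / real m) = 0 then 0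
              else (-1) ^ n / 2 ^ (\<Sum>i\<le>n. cfrac_digit (1 / real m) i))"
    using g by (intro suminf_finite) auto
  then show ?thesis
    using assms by (simp add: question_mark_def cfrac_digit_def)
qed

lemma question_mark_1: "question_mark 1 = 1"
  using question_mark_inverse_nat[of 1] by simp

text \<open>
  Piecewise continuity on the real line: only finitely many discontinuities in each bounded
  interval. Finite one-sided limits at the discontinuities are not demanded, so boundedness is not
  implied.
\<close>

definition piecewise_continuous :: "(real \<Rightarrow> real) \<Rightarrow> bool" where
  "piecewise_continuous f \<longleftrightarrow> (\<forall>a b. finite {x \<in> {a..b}. \<not> isCont f x})"

definition has_bounded_variation_on :: "(real \<Rightarrow> real) \<Rightarrow> real \<Rightarrow> real \<Rightarrow> bool" where
  "has_bounded_variation_on f a b \<longleftrightarrow>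
     (\<exists>V. \<forall>(m::nat) (t::nat \<Rightarrow> real).
        t 0 = a \<and> t m = b \<and> (\<forall>i<m. t i \<le> t (Suc i)) \<longrightarrow>
        (\<Sum>i<m. \<bar>f (t (Suc i)) - f (t i)\<bar>) \<le> V)"

end

theory Submission
  imports Defs
begin

text \<open>
  Under the question mark function, doubling modulo \<open>1\<close> becomes the Farey-type map \<open>T\<close> of \<open>[0,1]\<close>
  with inverse branches \<open>y / (1 + y)\<close> and \<open>1 / (2 - y)\<close>, so the integrals to be estimated are
  correlations along \<open>T\<close>. This map has indifferent fixed points at \<open>0\<close> and \<open>1\<close>, so there
  is no spectral gap; the decay comes from a monotonicity instead.

  Write \<open>\<phi>\<^sub>n x = j (2\<^sup>n ?(x))\<close>. Since \<open>?(1 - x) = 1 - ?(x)\<close> and \<open>j\<close> is odd and periodic,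
  \<open>\<phi>\<^sub>n (1 - x) = - \<phi>\<^sub>n x\<close>, so everything can be folded onto \<open>[0, 1/2]\<close>. Splitting the integral of
  \<open>\<phi>\<^sub>n\<^sub>+\<^sub>1 u\<close> over \<open>[0, 1/2]\<close> at \<open>1/3\<close> and substituting in each part turns it into the integral of
  \<open>\<phi>\<^sub>n (P u)\<close>, where
  \<open>P u y = u (y / (1 + y)) / (1 + y)\<^sup>2 - u ((1 - y) / (2 - y)) / (2 - y)\<^sup>2\<close>
  is the transfer operator of \<open>T\<close> on odd densities (\<open>integral_folded_transfer\<close>). The minus sign, which
  is the oddness of \<open>j\<close>, has two consequences for a nonnegative decreasing \<open>u\<close>: the first term
  dominates and decreases while the subtracted one increases, so \<open>P u\<close> is again nonnegative and
  decreasing (\<open>folded_transfer_preserves\<close>); and dropping the subtracted term gives an upper bound, so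
  only the parabolic branch \<open>y / (1 + y)\<close> matters. Its \<open>n\<close>-th iterate is \<open>y / (1 + n y)\<close>, hence
  \<open>0 \<le> P\<^sup>n u (y) \<le> u 0 / (1 + n y)\<^sup>2\<close>, whose integral over \<open>[0, 1/2]\<close> is \<open>u 0 / (n + 2)\<close>. As \<open>j\<close> is
  bounded, this is the desired rate for decreasing weights (\<open>integral_question_mark_decay\<close>).

  For the theorem, \<open>F\<close> is a difference of two increasing functions on \<open>[1/2, 1]\<close>; reflection makes
  each of them decreasing on \<open>[0, 1/2]\<close>, and up to a constant nonnegative.
\<close>

section \<open>Functional equations\<close>

lemma question_mark_borel_measurable [measurable]: "question_mark \<in> borel_measurable borel"
proof -
  have gauss [measurable]: "gauss_map \<in> borel_measurable borel"
    unfolding gauss_map_def frac_def by measurable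
  have remainder [measurable]: "gauss_map ^^ n \<in> borel_measurable borel" for n
    by (induction n) (auto intro: measurable_comp gauss)
  have digit [measurable]: "(\<lambda>x. cfrac_digit x n) \<in> measurable borel (count_space UNIV)" for n
    unfolding cfrac_digit_def by measurable
  show ?thesis
    unfolding question_mark_def by measurable
qed

text \<open>
  For \<open>0 < y\<close> the reciprocal of \<open>y / (1 + y)\<close> is \<open>1 / y + 1\<close>: the first partial quotient grows by
  \<open>1\<close> and the others stay, so every term of the series is halved.
\<close>

lemma question_mark_left_branch:
  assumes y: "0 \<le> y" "y \<le> 1"
  shows "question_mark (y / (1 + y)) = question_mark y / 2"
proof (cases "y = 0")
  case False
  define z where "z = y / (1 + y)"
  have inv: "1 / z = 1 / y + 1" and z: "z \<noteq> 0"
    using y False by (simp_all add: z_def field_simps)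
  have g1: "gauss_map z = gauss_map y"
    unfolding gauss_map_def inv by (simp add: frac_def)
  have g: "(gauss_map ^^ Suc n) z = (gauss_map ^^ Suc n) y" for n
    by (induction n) (simp_all add: g1)
  have d0: "cfrac_digit z 0 = Suc (cfrac_digit y 0)"
    unfolding cfrac_digit_def using y
    by (simp only: funpow_0 inv one_add_floor[symmetric]) (simp add: nat_add_distrib)
  have dS: "cfrac_digit z (Suc n) = cfrac_digit y (Suc n)" for n
    unfolding cfrac_digit_def g ..
  have dsum: "(\<Sum>i\<le>n. cfrac_digit z i) = Suc (\<Sum>i\<le>n. cfrac_digit y i)" for n
    by (induction n) (simp_all add: d0 dS)
  have zero: "(gauss_map ^^ n) z = 0 \<longleftrightarrow> (gauss_map ^^ n) y = 0" for n
    using z False g by (cases n) auto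
  have "(if (gauss_map ^^ n) z = 0 then 0 else (-1) ^ n / 2 ^ (\<Sum>i\<le>n. cfrac_digit z i) :: real)
      = (1/2) * (if (gauss_map ^^ n) y = 0 then 0 else (-1) ^ n / 2 ^ (\<Sum>i\<le>n. cfrac_digit y i))" for n
    unfolding zero dsum by simp
  then show ?thesis
    unfolding question_mark_def z_def[symmetric]
    by (simp only: suminf_mult[OF question_mark_summable[OF y]])
qed (simp add: question_mark_0)

text \<open>
  Passing from \<open>y = [0; a\<^sub>1, a\<^sub>2, \<dots>]\<close> to \<open>1 / (1 + y) = [0; 1, a\<^sub>1, a\<^sub>2, \<dots>]\<close> shifts the alternating
  series by one place. At \<open>y = 1\<close> the Gauss map yields the other expansion \<open>1/2 = [0; 2]\<close>, so that
  point is computed separately.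
\<close>

lemma question_mark_prepend_1:
  assumes "0 \<le> y" "y \<le> 1"
  shows "question_mark (1 / (1 + y)) = 1 - question_mark y / 2"
proof (cases "y = 1")
  case True
  then show ?thesis
    using question_mark_inverse_nat[of 2] by (simp add: question_mark_1)
next
  case False
  define z where "z = 1 / (1 + y)"
  have z: "0 \<le> z" "z \<le> 1" "z \<noteq> 0"
    using assms by (simp_all add: z_def)
  have inv: "1 / z = y + 1"
    using assms by (simp add: z_def)
  have fl: "\<lfloor>y\<rfloor> = 0"
    using assms False by (simp add: floor_eq_iff)
  have g1: "gauss_map z = y"
    unfolding gauss_map_def inv using fl by (simp add: frac_def)
  have g: "(gauss_map ^^ Suc n) z = (gauss_map ^^ n) y" for n
    by (induction n) (simp_all add: g1)
  have d0: "cfrac_digit z 0 = 1"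
    by (simp add: cfrac_digit_def inv fl)
  have dS: "cfrac_digit z (Suc n) = cfrac_digit y n" for n
    unfolding cfrac_digit_def g ..
  have dsum: "(\<Sum>i\<le>Suc n. cfrac_digit z i) = Suc (\<Sum>i\<le>n. cfrac_digit y i)" for n
    by (subst sum.atMost_Suc_shift) (simp add: d0 dS)
  define s where "s = (\<lambda>x n. if (gauss_map ^^ n) x = 0 then 0
                     else (-1) ^ n / 2 ^ (\<Sum>i\<le>n. cfrac_digit x i) :: real)"
  have sS: "s z (Suc n) = (-1/2) * s y n" for n
    unfolding s_def g dsum by simp
  have sums: "summable (s z)" "summable (s y)"
    using question_mark_summable[of z] question_mark_summable[of y] assms z
    unfolding s_def by simp_all
  have "(\<Sum>n. s z n) = (\<Sum>n. s z (Suc n)) + s z 0"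
    using suminf_split_head[OF sums(1)] by simp
  also have "\<dots> = (-1/2) * (\<Sum>n. s y n) + 1/2"
    unfolding sS suminf_mult[OF sums(2)] using z d0 by (simp add: s_def)
  finally have "2 * (\<Sum>n. s z n) = 1 - 2 * (\<Sum>n. s y n) / 2"
    by simp
  then show ?thesis
    unfolding question_mark_def s_def z_def .
qed

text \<open>
  The points \<open>x = y / (1 + y)\<close> and \<open>1 - x = 1 / (1 + y)\<close> with \<open>0 \<le> y \<le> 1\<close> are the mirror pairs with
  \<open>x \<le> 1/2\<close>, so the two preceding equations add up to the symmetry.
\<close>

lemma question_mark_reflect:
  assumes "0 \<le> x" "x \<le> 1"
  shows "question_mark (1 - x) = 1 - question_mark x"
proof -
  have half: "question_mark (1 - x) = 1 - question_mark x" if "0 \<le> x" "x \<le> 1/2" for x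
  proof -
    define y where "y = x / (1 - x)"
    have y: "0 \<le> y" "y \<le> 1" "x = y / (1 + y)" "1 - x = 1 / (1 + y)"
      using that by (simp_all add: y_def field_simps)
    show ?thesis
      using question_mark_left_branch[OF y(1,2)] question_mark_prepend_1[OF y(1,2)] y(3,4) by simp
  qed
  show ?thesis
    using half[of x] half[of "1 - x"] assms by (cases "x \<le> 1/2") auto
qed

text \<open>
  The branch \<open>1 / (2 - y)\<close> of the doubling dynamics lands in \<open>[1/2, 1]\<close>; its mirror image
  \<open>(1 - y) / (2 - y)\<close> is the branch that stays in \<open>[0, 1/2]\<close>.
\<close>

lemma question_mark_folded_right_branch:
  assumes "0 \<le> y" "y \<le> 1"
  shows "question_mark ((1 - y) / (2 - y)) = (1 - question_mark y) / 2"
  using question_mark_left_branch[of "1 - y"] question_mark_reflect[of y] assms by simp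

section \<open>Periodic odd functions\<close>

lemma periodic_add_nat:
  assumes "\<And>x. j (x + 1) = j (x :: real)"
  shows "j (x + real n) = j x"
proof (induction n)
  case (Suc n)
  then show ?case
    using assms[of "x + real n"] by (simp add: add_ac)
qed simp

lemma periodic_odd_reflect:
  assumes "\<And>x. j (x + 1) = j (x :: real)" "\<And>x. j (- x) = - (j x :: real)"
  shows "j (real n - x) = - j x"
  using periodic_add_nat[of j "- x" n, OF assms(1)] assms(2) by (simp add: add.commute)

lemma periodic_bounded:
  fixes j :: "real \<Rightarrow> real"
  assumes per: "\<And>x. j (x + 1) = j x" and bdd: "bdd_above ((\<lambda>x. \<bar>j x\<bar>) ` {0..1})"
  obtains M where "\<And>x. \<bar>j x\<bar> \<le> M"
proof -
  obtain M where M: "\<bar>j x\<bar> \<le> M" if "0 \<le> x" "x \<le> 1" for x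
    using bdd unfolding bdd_above_def by (metis atLeastAtMost_iff imageI)
  have "\<bar>j x\<bar> \<le> M" for x
  proof -
    \<comment> \<open>Shifting \<open>x\<close> to be nonnegative makes its integer part a natural number.\<close>
    define k where "k = nat \<lceil>\<bar>x\<bar>\<rceil>"
    have "0 \<le> x + real k"
      unfolding k_def by linarith
    then have "x + real k = frac (x + real k) + real (nat \<lfloor>x + real k\<rfloor>)"
      unfolding frac_def by linarith
    then have "j x = j (frac (x + real k))"
      using periodic_add_nat[of j x k, OF per] periodic_add_nat[of j _ "nat \<lfloor>x + real k\<rfloor>", OF per]
      by metis
    then show ?thesis
      using M[of "frac (x + real k)"] by (simp add: frac_lt_1 less_imp_le)
  qed
  then show thesis
    by (rule that)
qed

lemma piecewise_continuous_borel_measurable: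
  assumes "piecewise_continuous j"
  shows "j \<in> borel_measurable borel"
proof (rule borel_measurable_continuous_countable_exceptions)
  have "{x. \<not> isCont j x} = (\<Union>n. {x \<in> {- real n..real n}. \<not> isCont j x})"
  proof -
    have "\<exists>n. - real n \<le> x \<and> x \<le> real n" for x :: real
      using real_arch_simple[of "\<bar>x\<bar>"] by (auto simp: abs_le_iff minus_le_iff)
    then show ?thesis by auto
  qed
  also have "countable \<dots>"
    using assms unfolding piecewise_continuous_def by (intro countable_UN) (auto intro: countable_finite)
  finally show "countable {x. \<not> isCont j x}" .
  show "continuous_on (- {x. \<not> isCont j x}) j"
    by (auto simp: continuous_on_eq_continuous_at intro!: continuous_at_imp_continuous_on)
qed

section \<open>Decay against decreasing weights\<close>

lemma absolutely_integrable_bounded_times_antimono: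
  fixes g u :: "real \<Rightarrow> real"
  assumes [measurable]: "g \<in> borel_measurable borel" and g: "\<And>x. \<bar>g x\<bar> \<le> M"
    and u: "antimono_on {a..b} u"
  shows "(\<lambda>x. g x * u x) absolutely_integrable_on {a..b}"
proof (rule measurable_bounded_by_integrable_imp_absolutely_integrable)
  have "mono_on {a..b} (\<lambda>x. - u x)"
    using u by (auto simp: monotone_on_def)
  then have "(\<lambda>x. - (- u x)) \<in> borel_measurable (restrict_space borel {a..b})"
    by (intro borel_measurable_uminus borel_measurable_mono_on_fnc)
  then have "(\<lambda>x. g x * u x) \<in> borel_measurable (restrict_space borel {a..b})"
    by (intro borel_measurable_times) (auto intro: measurable_restrict_space1)
  then show "(\<lambda>x. g x * u x) \<in> borel_measurable (lebesgue_on {a..b})"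
    by (simp add: borel_measurable_restrict_space_iff measurable_completion)
  show "(\<lambda>x. M * (\<bar>u a\<bar> + \<bar>u b\<bar>)) integrable_on {a..b}"
    by (rule integrable_on_const) simp
  fix x assume x: "x \<in> {a..b}"
  then have "u b \<le> u x" "u x \<le> u a"
    using u by (auto simp: monotone_on_def)
  then show "norm (g x * u x) \<le> M * (\<bar>u a\<bar> + \<bar>u b\<bar>)"
    unfolding norm_mult using g[of x] by (intro mult_mono) auto
qed simp

lemma integral_left_branch:
  fixes f :: "real \<Rightarrow> real"
  assumes "f absolutely_integrable_on {0..1/3}"
  shows "(\<lambda>y. f (y / (1 + y)) / (1 + y)\<^sup>2) absolutely_integrable_on {0..1/2}"
    and "integral {0..1/3} f = integral {0..1/2} (\<lambda>y. f (y / (1 + y)) / (1 + y)\<^sup>2)"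
proof -
  have im: "(\<lambda>y::real. y / (1 + y)) ` {0..1/2} = {0..1/3}"
  proof (intro set_eqI iffI)
    fix x :: real assume "x \<in> {0..1/3}"
    then show "x \<in> (\<lambda>y. y / (1 + y)) ` {0..1/2}"
      by (intro image_eqI[of _ _ "x / (1 - x)"]) (auto simp: field_simps)
  qed (auto simp: field_simps)
  have "((\<lambda>y. y / (1 + y)) has_field_derivative 1 / (1 + y)\<^sup>2) (at y within {0..1/2})"
    if "y \<in> {0..1/2}" for y :: real
    using that by (auto intro!: derivative_eq_intros simp: power2_eq_square field_simps)
  moreover have "inj_on (\<lambda>y::real. y / (1 + y)) {0..1/2}"
    by (auto simp: inj_on_def field_simps)
  ultimately have "(\<lambda>y. \<bar>1 / (1 + y)\<^sup>2\<bar> * f (y / (1 + y))) absolutely_integrable_on {0..1/2} \<and>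
        integral {0..1/2} (\<lambda>y. \<bar>1 / (1 + y)\<^sup>2\<bar> * f (y / (1 + y))) = integral {0..1/3} f"
    using assms by (subst has_absolute_integral_change_of_variables_1') (auto simp: im)
  then show "(\<lambda>y. f (y / (1 + y)) / (1 + y)\<^sup>2) absolutely_integrable_on {0..1/2}"
    and "integral {0..1/3} f = integral {0..1/2} (\<lambda>y. f (y / (1 + y)) / (1 + y)\<^sup>2)"
    by simp_all
qed

lemma integral_folded_right_branch:
  fixes f :: "real \<Rightarrow> real"
  assumes "f absolutely_integrable_on {1/3..1/2}"
  shows "(\<lambda>y. f ((1 - y) / (2 - y)) / (2 - y)\<^sup>2) absolutely_integrable_on {0..1/2}"
    and "integral {1/3..1/2} f = integral {0..1/2} (\<lambda>y. f ((1 - y) / (2 - y)) / (2 - y)\<^sup>2)"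
proof -
  have im: "(\<lambda>y::real. (1 - y) / (2 - y)) ` {0..1/2} = {1/3..1/2}"
  proof (intro set_eqI iffI)
    fix x :: real assume "x \<in> {1/3..1/2}"
    then show "x \<in> (\<lambda>y. (1 - y) / (2 - y)) ` {0..1/2}"
      by (intro image_eqI[of _ _ "(1 - 2 * x) / (1 - x)"]) (auto simp: field_simps)
  qed (auto simp: field_simps)
  have "((\<lambda>y. (1 - y) / (2 - y)) has_field_derivative - (1 / (2 - y)\<^sup>2)) (at y within {0..1/2})"
    if "y \<in> {0..1/2}" for y :: real
    using that by (auto intro!: derivative_eq_intros simp: power2_eq_square field_simps)
  moreover have "inj_on (\<lambda>y::real. (1 - y) / (2 - y)) {0..1/2}"
    by (auto simp: inj_on_def field_simps)
  ultimately have "(\<lambda>y. \<bar>- (1 / (2 - y)\<^sup>2)\<bar> * f ((1 - y) / (2 - y))) absolutely_integrable_on {0..1/2} \<and>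
        integral {0..1/2} (\<lambda>y. \<bar>- (1 / (2 - y)\<^sup>2)\<bar> * f ((1 - y) / (2 - y))) = integral {1/3..1/2} f"
    using assms by (subst has_absolute_integral_change_of_variables_1') (auto simp: im)
  then show "(\<lambda>y. f ((1 - y) / (2 - y)) / (2 - y)\<^sup>2) absolutely_integrable_on {0..1/2}"
    and "integral {1/3..1/2} f = integral {0..1/2} (\<lambda>y. f ((1 - y) / (2 - y)) / (2 - y)\<^sup>2)"
    by simp_all
qed

text \<open>
  The Perron-Frobenius operator of the doubling dynamics, in the question mark coordinate, acting on
  densities that are odd about \<open>1/2\<close> and represented by their restriction to \<open>[0, 1/2]\<close>. The minus
  sign results from folding the branch in \<open>[1/2, 1]\<close> back by oddness.
\<close>

definition folded_transfer :: "(real \<Rightarrow> real) \<Rightarrow> real \<Rightarrow> real" where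
  "folded_transfer u y = u (y / (1 + y)) / (1 + y)\<^sup>2 - u ((1 - y) / (2 - y)) / (2 - y)\<^sup>2"

text \<open>
  On \<open>[0, 1/2]\<close> the first branch lies to the left of the second and has the larger derivative, which
  gives nonnegativity. The first branch is increasing and the second, being folded, is decreasing;
  composed with a decreasing \<open>u\<close>, and together with the monotonicity of the two derivatives, both
  terms make the difference decrease.
\<close>

lemma folded_transfer_preserves:
  assumes anti: "antimono_on {0..1/2} u" and nonneg: "\<And>y. y \<in> {0..1/2} \<Longrightarrow> 0 \<le> u y"
  shows "antimono_on {0..1/2} (folded_transfer u)"
    and "\<And>y. y \<in> {0..1/2} \<Longrightarrow> 0 \<le> folded_transfer u y"
proof -
  have dec: "u y \<le> u x" if "0 \<le> x" "x \<le> y" "y \<le> 1/2" for x y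
    using anti that by (auto simp: monotone_on_def)
  have left: "0 \<le> y / (1 + y)" "y / (1 + y) \<le> 1/2" and right: "0 \<le> (1 - y) / (2 - y)" "(1 - y) / (2 - y) \<le> 1/2"
    and le: "y / (1 + y) \<le> (1 - y) / (2 - y)"
    if "0 \<le> y" "y \<le> 1/2" for y :: real
    using that by (auto simp: field_simps)
  show "0 \<le> folded_transfer u y" if "y \<in> {0..1/2}" for y
  proof -
    have "u ((1 - y) / (2 - y)) \<le> u (y / (1 + y))" "0 \<le> u (y / (1 + y))"
      using that left[of y] right[of y] le[of y] by (auto intro!: dec nonneg)
    moreover have "(1 + y)\<^sup>2 \<le> (2 - y)\<^sup>2" "0 < (1 + y)\<^sup>2"
      using that by (auto intro!: power_mono)
    ultimately have "u ((1 - y) / (2 - y)) / (2 - y)\<^sup>2 \<le> u (y / (1 + y)) / (1 + y)\<^sup>2"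
      by (intro frac_le)
    then show ?thesis
      by (simp add: folded_transfer_def)
  qed
  show "antimono_on {0..1/2} (folded_transfer u)"
  proof (rule monotone_onI)
    fix x y :: real assume xy: "x \<in> {0..1/2}" "y \<in> {0..1/2}" "x \<le> y"
    have "x / (1 + x) \<le> y / (1 + y)" "(1 - y) / (2 - y) \<le> (1 - x) / (2 - x)"
      using xy by (auto simp: field_simps)
    then have "u (y / (1 + y)) / (1 + y)\<^sup>2 \<le> u (x / (1 + x)) / (1 + x)\<^sup>2"
      and "u ((1 - x) / (2 - x)) / (2 - x)\<^sup>2 \<le> u ((1 - y) / (2 - y)) / (2 - y)\<^sup>2"
      using xy left right by (auto intro!: frac_le[OF _ dec] nonneg power_mono)
    then show "folded_transfer u y \<le> folded_transfer u x"
      by (simp add: folded_transfer_def)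
  qed
qed

text \<open>
  The family \<open>U / (1 + k y)\<^sup>2\<close> is the orbit of the constant \<open>U\<close> under the first term of the operator:
  the substitution \<open>y / (1 + y)\<close> with its derivative raises \<open>k\<close> by \<open>1\<close>.
\<close>

lemma folded_transfer_le:
  assumes nonneg: "\<And>y. y \<in> {0..1/2} \<Longrightarrow> 0 \<le> u y"
    and le: "\<And>y. y \<in> {0..1/2} \<Longrightarrow> u y \<le> U / (1 + real k * y)\<^sup>2"
    and y: "y \<in> {0..1/2}"
  shows "folded_transfer u y \<le> U / (1 + real (Suc k) * y)\<^sup>2"
proof -
  have "folded_transfer u y \<le> u (y / (1 + y)) / (1 + y)\<^sup>2"
    using nonneg[of "(1 - y) / (2 - y)"] y by (auto simp: folded_transfer_def field_simps)
  also have "\<dots> \<le> U / (1 + real k * (y / (1 + y)))\<^sup>2 / (1 + y)\<^sup>2"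
    using y by (intro divide_right_mono le) (auto simp: field_simps)
  also have "\<dots> = U / ((1 + real k * (y / (1 + y))) * (1 + y))\<^sup>2"
    by (simp add: power_mult_distrib)
  also have "(1 + real k * (y / (1 + y))) * (1 + y) = 1 + real (Suc k) * y"
    using y by (simp add: field_simps)
  finally show ?thesis .
qed

text \<open>
  This is the duality between composition with the dynamics and the transfer operator. On
  \<open>[0, 1/3]\<close> the first branch turns \<open>2\<^sup>n\<^sup>+\<^sup>1 ?(x)\<close> into \<open>2\<^sup>n ?(y)\<close>; on \<open>[1/3, 1/2]\<close> the folded second
  branch turns it into \<open>2\<^sup>n - 2\<^sup>n ?(y)\<close>, where \<open>j\<close> changes sign.
\<close>

lemma integral_folded_transfer:
  fixes j u :: "real \<Rightarrow> real"
  assumes j: "j \<in> borel_measurable borel" "\<And>x. \<bar>j x\<bar> \<le> M"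
    and per: "\<And>x. j (x + 1) = j x" and odd: "\<And>x. j (- x) = - j x"
    and anti: "antimono_on {0..1/2} u"
  shows "integral {0..1/2} (\<lambda>x. j (2 ^ Suc n * question_mark x) * u x)
       = integral {0..1/2} (\<lambda>x. j (2 ^ n * question_mark x) * folded_transfer u x)"
proof -
  note [measurable] = j(1)
  define f where "f = (\<lambda>x. j (2 ^ Suc n * question_mark x) * u x)"
  define L where "L = (\<lambda>y. f (y / (1 + y)) / (1 + y)\<^sup>2)"
  define R where "R = (\<lambda>y. f ((1 - y) / (2 - y)) / (2 - y)\<^sup>2)"
  have f: "f absolutely_integrable_on {0..1/2}"
    unfolding f_def by (intro absolutely_integrable_bounded_times_antimono[OF _ j(2) anti]) measurable
  have f1: "f absolutely_integrable_on {0..1/3}" and f2: "f absolutely_integrable_on {1/3..1/2}"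
    by (auto intro: set_integrable_subset[OF f])
  have "integral {0..1/2} f = integral {0..1/3} f + integral {1/3..1/2} f"
    using set_lebesgue_integral_eq_integral(1)[OF f]
    by (intro Henstock_Kurzweil_Integration.integral_combine[symmetric]) auto
  also have "\<dots> = integral {0..1/2} L + integral {0..1/2} R"
    unfolding L_def R_def integral_left_branch(2)[OF f1] integral_folded_right_branch(2)[OF f2] ..
  also have "\<dots> = integral {0..1/2} (\<lambda>y. L y + R y)"
    using integral_left_branch(1)[OF f1] integral_folded_right_branch(1)[OF f2]
    unfolding L_def R_def
    by (intro Henstock_Kurzweil_Integration.integral_add[symmetric] set_lebesgue_integral_eq_integral(1))
  also have "\<dots> = integral {0..1/2} (\<lambda>x. j (2 ^ n * question_mark x) * folded_transfer u x)"
  proof (rule Henstock_Kurzweil_Integration.integral_cong)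
    fix y :: real assume y: "y \<in> {0..1/2}"
    have left: "2 ^ Suc n * question_mark (y / (1 + y)) = 2 ^ n * question_mark y"
      using y question_mark_left_branch[of y] by simp
    have "2 ^ Suc n * question_mark ((1 - y) / (2 - y)) = real (2 ^ n) - 2 ^ n * question_mark y"
      using y by (subst question_mark_folded_right_branch) (auto simp: right_diff_distrib)
    then have right: "j (2 ^ Suc n * question_mark ((1 - y) / (2 - y))) = - j (2 ^ n * question_mark y)"
      by (simp only: periodic_odd_reflect[of j, OF per odd])
    show "L y + R y = j (2 ^ n * question_mark y) * folded_transfer u y"
      unfolding L_def R_def f_def left right folded_transfer_def by (simp add: algebra_simps)
  qed
  finally show ?thesis
    unfolding f_def .
qed

lemma has_integral_parabolic_majorant:
  "((\<lambda>y. 1 / (1 + real k * y)\<^sup>2) has_integral 1 / (real k + 2)) {0..1/2}"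
proof -
  have "((\<lambda>y. 1 / (1 + real k * y)\<^sup>2) has_integral
      (1/2) / (1 + real k * (1/2)) - 0 / (1 + real k * 0)) {0..1/2}"
  proof (rule fundamental_theorem_of_calculus)
    fix y :: real assume "y \<in> {0..1/2}"
    then have "0 < 1 + real k * y"
      by (simp add: add_pos_nonneg)
    then show "((\<lambda>y. y / (1 + real k * y)) has_vector_derivative 1 / (1 + real k * y)\<^sup>2) (at y within {0..1/2})"
      unfolding has_real_derivative_iff_has_vector_derivative[symmetric]
      by (auto intro!: derivative_eq_intros simp: power2_eq_square field_simps)
  qed simp
  moreover have "(1/2) / (1 + real k * (1/2)) - 0 / (1 + real k * 0) = 1 / (real k + 2)"
    by (simp add: field_simps)
  ultimately show ?thesis
    by (simp only:)
qed

text \<open>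
  The index \<open>k\<close> counts the applications of the transfer operator already carried out: each step of
  the induction lowers \<open>n\<close> and raises \<open>k\<close>, keeping \<open>n + k\<close>, until the majorant is integrated.
\<close>

lemma integral_question_mark_decay_majorant:
  fixes j u :: "real \<Rightarrow> real"
  assumes j: "j \<in> borel_measurable borel" "\<And>x. \<bar>j x\<bar> \<le> M"
    and per: "\<And>x. j (x + 1) = j x" and odd: "\<And>x. j (- x) = - j x"
    and "antimono_on {0..1/2} u" "\<And>y. y \<in> {0..1/2} \<Longrightarrow> 0 \<le> u y"
    and "\<And>y. y \<in> {0..1/2} \<Longrightarrow> u y \<le> U / (1 + real k * y)\<^sup>2"
  shows "\<bar>integral {0..1/2} (\<lambda>x. j (2 ^ n * question_mark x) * u x)\<bar> \<le> M * U / (real (n + k) + 2)"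
  using assms(5-)
proof (induction n arbitrary: k u)
  case 0
  note [measurable] = j(1)
  have bound: "((\<lambda>y. M * U * (1 / (1 + real k * y)\<^sup>2)) has_integral M * U * (1 / (real k + 2))) {0..1/2}"
    by (intro has_integral_mult_right has_integral_parabolic_majorant)
  have "norm (integral {0..1/2} (\<lambda>x. j (2 ^ 0 * question_mark x) * u x))
      \<le> integral {0..1/2} (\<lambda>y. M * U * (1 / (1 + real k * y)\<^sup>2))"
  proof (rule Henstock_Kurzweil_Integration.integral_norm_bound_integral)
    show "(\<lambda>x. j (2 ^ 0 * question_mark x) * u x) integrable_on {0..1/2}"
      by (intro set_lebesgue_integral_eq_integral(1)
          absolutely_integrable_bounded_times_antimono[OF _ j(2) "0.prems"(1)]) measurable
    show "(\<lambda>y. M * U * (1 / (1 + real k * y)\<^sup>2)) integrable_on {0..1/2}"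
      using bound by blast
    fix y :: real assume y: "y \<in> {0..1/2}"
    have "\<bar>j (2 ^ 0 * question_mark y)\<bar> * \<bar>u y\<bar> \<le> M * (U / (1 + real k * y)\<^sup>2)"
      using j(2)[of 0] "0.prems"(2,3)[OF y] by (intro mult_mono j(2)) auto
    then show "norm (j (2 ^ 0 * question_mark y) * u y) \<le> M * U * (1 / (1 + real k * y)\<^sup>2)"
      by (simp add: abs_mult)
  qed
  then show ?case
    using integral_unique[OF bound] by simp
next
  case (Suc n)
  have "\<bar>integral {0..1/2} (\<lambda>x. j (2 ^ n * question_mark x) * folded_transfer u x)\<bar>
      \<le> M * U / (real (n + Suc k) + 2)"
    using Suc.prems by (intro Suc.IH folded_transfer_preserves folded_transfer_le) auto
  then show ?case
    unfolding integral_folded_transfer[OF j per odd Suc.prems(1)] by simp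
qed

lemma integral_question_mark_decay:
  fixes j u :: "real \<Rightarrow> real"
  assumes j: "j \<in> borel_measurable borel" "\<And>x. \<bar>j x\<bar> \<le> M"
    and per: "\<And>x. j (x + 1) = j x" and odd: "\<And>x. j (- x) = - j x"
    and anti: "antimono_on {0..1/2} u" and nonneg: "\<And>y. y \<in> {0..1/2} \<Longrightarrow> 0 \<le> u y"
  shows "\<bar>integral {0..1/2} (\<lambda>x. j (2 ^ n * question_mark x) * u x)\<bar> \<le> M * u 0 / (real n + 2)"
proof -
  have "u y \<le> u 0 / (1 + real 0 * y)\<^sup>2" if "y \<in> {0..1/2}" for y
    using anti that by (auto simp: monotone_on_def)
  from integral_question_mark_decay_majorant[OF j per odd anti nonneg this] show ?thesis
    by simp
qed

section \<open>Jordan decomposition\<close>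

text \<open>
  Take the variation function \<open>p x\<close>, the supremum of the variation sums over partitions of
  \<open>[a, x]\<close>. Appending a point \<open>y\<close> to such a partition shows \<open>p x + \<bar>F y - F x\<bar> \<le> p y\<close>, which makes
  both \<open>p\<close> and \<open>p - F\<close> increasing.
\<close>

lemma has_bounded_variation_on_jordan:
  assumes bv: "has_bounded_variation_on F a b"
  obtains p q where "mono_on {a..b} p" "mono_on {a..b} q"
    "\<And>x. x \<in> {a..b} \<Longrightarrow> F x = p x - q x"
proof -
  define S where "S = (\<lambda>x. {(\<Sum>i<m. \<bar>F (t (Suc i)) - F (t i)\<bar>) | m t.
    t 0 = a \<and> t m = x \<and> (\<forall>i<m. t i \<le> t (Suc i))})"
  obtain V where V: "\<And>(m::nat) t. t 0 = a \<Longrightarrow> t m = b \<Longrightarrow> \<forall>i<m. t i \<le> t (Suc i) \<Longrightarrow>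
        (\<Sum>i<m. \<bar>F (t (Suc i)) - F (t i)\<bar>) \<le> V"
    using bv unfolding has_bounded_variation_on_def by blast
  have extend: "s + \<bar>F y - F x\<bar> \<in> S y" if "s \<in> S x" "x \<le> y" for s x y
  proof -
    from that(1) obtain m t where t: "t 0 = a" "t m = x" "\<forall>i<m. t i \<le> t (Suc i)"
      and s: "s = (\<Sum>i<m. \<bar>F (t (Suc i)) - F (t i)\<bar>)"
      unfolding S_def by blast
    define t' where "t' = t(Suc m := y)"
    have "s + \<bar>F y - F x\<bar> = (\<Sum>i<Suc m. \<bar>F (t' (Suc i)) - F (t' i)\<bar>)"
      by (simp add: s t'_def t(2))
    moreover have "t' 0 = a" "t' (Suc m) = y" "\<forall>i<Suc m. t' i \<le> t' (Suc i)"
      using t that(2) by (auto simp: t'_def less_Suc_eq)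
    ultimately show ?thesis
      unfolding S_def by blast
  qed
  \<comment> \<open>Appending the endpoint \<open>b\<close> completes a partition of \<open>[a, x]\<close> to one of \<open>[a, b]\<close>.\<close>
  have bdd: "bdd_above (S x)" if "x \<le> b" for x
  proof (rule bdd_aboveI)
    fix s assume "s \<in> S x"
    from extend[OF this that] have "s + \<bar>F b - F x\<bar> \<le> V"
      unfolding S_def by (auto intro: V)
    then show "s \<le> V" by simp
  qed
  have "0 \<in> S a"
    unfolding S_def by (auto intro!: exI[of _ "0::nat"] exI[of _ "\<lambda>_. a"])
  then have ne: "S x \<noteq> {}" if "a \<le> x" for x
    using extend that by blast
  define p where "p = (\<lambda>x. Sup (S x))"
  have step: "p x + \<bar>F y - F x\<bar> \<le> p y" if "a \<le> x" "x \<le> y" "y \<le> b" for x y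
  proof -
    have "Sup (S x) \<le> p y - \<bar>F y - F x\<bar>"
    proof (rule cSup_least[OF ne[OF that(1)]])
      fix s assume "s \<in> S x"
      from cSup_upper[OF extend[OF this that(2)] bdd[OF that(3)]]
      show "s \<le> p y - \<bar>F y - F x\<bar>"
        by (simp add: p_def)
    qed
    then show ?thesis
      by (simp add: p_def)
  qed
  show thesis
  proof
    show "mono_on {a..b} p"
      by (rule monotone_onI) (use step in fastforce)
    show "mono_on {a..b} (\<lambda>x. p x - F x)"
      by (rule monotone_onI) (use step in fastforce)
  qed simp
qed

section \<open>The integral over the upper half\<close>

lemma integral_upper_half_reflect:
  fixes f :: "real \<Rightarrow> real"
  shows "integral {1/2..1} f = integral {0..1/2} (\<lambda>x. f (1 - x))"
  using integral_reflect_real[of 1 "1/2" f] integral_shift_Icc_real[of 0 "1/2" "\<lambda>x. f (- x)" "-1"]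
  by (simp add: o_def)

theorem theorem2:
  fixes j F :: "real \<Rightarrow> real"
  assumes j_periodic: "\<And>x. j (x + 1) = j x"
    and j_odd: "\<And>x. j (- x) = - j x"
    and j_piecewise_continuous: "piecewise_continuous j"
    and j_bounded: "bdd_above ((\<lambda>x. \<bar>j x\<bar>) ` {0..1})"
    and F_continuous: "continuous_on {1/2..1} F"
    and F_bounded_variation: "has_bounded_variation_on F (1/2) 1"
  shows "(\<lambda>n::nat. integral {1/2..1} (\<lambda>x. j (2 ^ n * question_mark x) * F x))
           \<in> O(\<lambda>n. 1 / real n)"
proof -
  obtain M where M: "\<And>x. \<bar>j x\<bar> \<le> M"
    using periodic_bounded[OF j_periodic j_bounded] by blast
  have j [measurable]: "j \<in> borel_measurable borel"
    by (rule piecewise_continuous_borel_measurable[OF j_piecewise_continuous])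
  obtain p q where p: "mono_on {1/2..1} p" and q: "mono_on {1/2..1} q"
    and F: "\<And>x. x \<in> {1/2..1} \<Longrightarrow> F x = p x - q x"
    using has_bounded_variation_on_jordan[OF F_bounded_variation] by auto
  \<comment> \<open>Subtracting the minimum \<open>r (1/2)\<close> makes the reflected weight nonnegative; the constant that is
      left over is itself a decreasing weight.\<close>
  have decay: "\<bar>integral {0..1/2} (\<lambda>x. j (2 ^ n * question_mark x) * r (1 - x))\<bar>
        \<le> M * ((r 1 - r (1/2)) + \<bar>r (1/2)\<bar>) / (real n + 2)"
    and int_r: "(\<lambda>x. j (2 ^ n * question_mark x) * r (1 - x)) integrable_on {0..1/2}"
    if r: "mono_on {1/2..1} r" for r :: "real \<Rightarrow> real" and n :: nat
  proof -
    let ?\<phi> = "\<lambda>x. j (2 ^ n * question_mark x)"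
    define u where "u = (\<lambda>x. r (1 - x) - r (1/2))"
    have u: "antimono_on {0..1/2} u" and u_nonneg: "\<And>y. y \<in> {0..1/2} \<Longrightarrow> 0 \<le> u y"
      using r by (auto simp: u_def monotone_on_def)
    have one: "antimono_on {0..1/2} (\<lambda>_::real. 1::real)"
      by (simp add: monotone_on_def)
    have int: "(\<lambda>x. ?\<phi> x * v x) integrable_on {0..1/2}" if "antimono_on {0..1/2} v" for v :: "real \<Rightarrow> real"
      by (intro set_lebesgue_integral_eq_integral(1)
          absolutely_integrable_bounded_times_antimono[OF _ M that]) measurable
    have split: "?\<phi> x * r (1 - x) = ?\<phi> x * u x + r (1/2) * (?\<phi> x * 1)" for x
      by (simp add: u_def algebra_simps)
    show "(\<lambda>x. ?\<phi> x * r (1 - x)) integrable_on {0..1/2}"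
      unfolding split by (intro integrable_add integrable_on_mult_right int u one)
    have "integral {0..1/2} (\<lambda>x. ?\<phi> x * r (1 - x))
        = integral {0..1/2} (\<lambda>x. ?\<phi> x * u x) + r (1/2) * integral {0..1/2} (\<lambda>x. ?\<phi> x * 1)"
      unfolding split
      by (subst Henstock_Kurzweil_Integration.integral_add)
        (intro integrable_on_mult_right int u one Henstock_Kurzweil_Integration.integral_mult_right refl
          arg_cong2[where f="(+)"])+
    moreover have "\<bar>integral {0..1/2} (\<lambda>x. ?\<phi> x * u x)\<bar> \<le> M * u 0 / (real n + 2)"
      by (rule integral_question_mark_decay[OF j M j_periodic j_odd u u_nonneg])
    moreover have "\<bar>integral {0..1/2} (\<lambda>x. ?\<phi> x * 1)\<bar> \<le> M * 1 / (real n + 2)"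
      by (rule integral_question_mark_decay[OF j M j_periodic j_odd one]) simp
    then have "\<bar>r (1/2) * integral {0..1/2} (\<lambda>x. ?\<phi> x * 1)\<bar> \<le> \<bar>r (1/2)\<bar> * (M * 1 / (real n + 2))"
      unfolding abs_mult by (intro mult_left_mono) auto
    ultimately have "\<bar>integral {0..1/2} (\<lambda>x. ?\<phi> x * r (1 - x))\<bar>
        \<le> M * u 0 / (real n + 2) + \<bar>r (1/2)\<bar> * (M * 1 / (real n + 2))"
      by linarith
    also have "\<dots> = M * ((r 1 - r (1/2)) + \<bar>r (1/2)\<bar>) / (real n + 2)"
      unfolding u_def by (simp add: add_divide_distrib distrib_left)
    finally show "\<bar>integral {0..1/2} (\<lambda>x. ?\<phi> x * r (1 - x))\<bar>
        \<le> M * ((r 1 - r (1/2)) + \<bar>r (1/2)\<bar>) / (real n + 2)" .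
  qed
  define A where "A = (\<lambda>r :: real \<Rightarrow> real. r 1 - r (1/2) + \<bar>r (1/2)\<bar>)"
  define K where "K = M * A p + M * A q"
  have "\<bar>integral {1/2..1} (\<lambda>x. j (2 ^ n * question_mark x) * F x)\<bar> \<le> \<bar>K\<bar> * \<bar>1 / real n\<bar>"
    if "n \<ge> 1" for n
  proof -
    let ?\<phi> = "\<lambda>x. j (2 ^ n * question_mark x)"
    have reflect: "?\<phi> (1 - x) = - ?\<phi> x" if "x \<in> {0..1/2}" for x
    proof -
      have "2 ^ n * question_mark (1 - x) = real (2 ^ n) - 2 ^ n * question_mark x"
        using that by (subst question_mark_reflect) (auto simp: right_diff_distrib)
      then show ?thesis
        by (simp only: periodic_odd_reflect[of j, OF j_periodic j_odd])
    qed
    have "integral {1/2..1} (\<lambda>x. ?\<phi> x * F x) = integral {0..1/2} (\<lambda>x. ?\<phi> (1 - x) * F (1 - x))"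
      by (rule integral_upper_half_reflect)
    also have "\<dots> = integral {0..1/2} (\<lambda>x. ?\<phi> x * q (1 - x) - ?\<phi> x * p (1 - x))"
      by (intro Henstock_Kurzweil_Integration.integral_cong, subst reflect)
        (auto simp: F right_diff_distrib)
    also have "\<dots> = integral {0..1/2} (\<lambda>x. ?\<phi> x * q (1 - x)) - integral {0..1/2} (\<lambda>x. ?\<phi> x * p (1 - x))"
      by (intro Henstock_Kurzweil_Integration.integral_diff int_r p q)
    finally have "\<bar>integral {1/2..1} (\<lambda>x. ?\<phi> x * F x)\<bar> \<le> M * A q / (real n + 2) + M * A p / (real n + 2)"
      using decay[OF p, of n] decay[OF q, of n] unfolding A_def by linarith
    also have "\<dots> = K / (real n + 2)"
      by (simp add: K_def add_divide_distrib)
    also have "\<dots> \<le> \<bar>K\<bar> / real n"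
      using that by (intro frac_le) auto
    finally show ?thesis
      by simp
  qed
  then show ?thesis
    by (intro bigoI[of _ "\<bar>K\<bar>"] eventually_sequentiallyI[of 1]) simp
qed

end
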